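(* For every $n\ge 1$, any two consecutive elements of the list $\mathcal{L}_n$ (defined in the context) differ in exactly one position, i.e. they have Hamming distance one.
   Context: Consider the succession rule for the Catalan numbers with axiom $(2)$ and productions $(k)\rightsquigarrow(2)(3)\cdots(k)(k+1)$ for $k\ge 2$. A word of length $n$ is a sequence $w_1w_2\cdots w_n$ of integers with $w_1=2$ and $w_{m+1}\in\{2,3,\dots,w_m+1\}$ for $1\le m<n$ (these are the root-to-node paths in the generating tree). For a list $L$ of words, $\mathrm{first}(L)$ and $\mathrm{last}(L)$ denote its first and last element; for a word $x$, $\overrightarrow{x}$ denotes its rightmost digit; $x\circ L$ denotes the list obtained by appending each element of the list $L$ (in order) to the word $x$; $\Theta$ denotes concatenation of lists. For $k\ge 2$ define the shifted productions (lists): $s(k,2)=\langle 2,k+1,k,k-1,\dots,4,3\rangle$ (i.e. $2$ followed by the integers from $k+1$ down to $3$; so $s(2,2)=\langle 2,3\rangle$), and for $3\le i\le k+1$, $s(k,i)=\langle i,i+1,\dots,k,k+1,2,3,\dots,i-1\rangle$. Define lists $\mathcal{L}_n$ recursively: $\mathcal{L}_1=\langle 2\rangle$, and for $n>1$, writing $l^{n-1}_i$ for the $i$-th element of $\mathcal{L}_{n-1}$ and $M=|\mathcal{L}_{n-1}|$, set $\mathcal{L}_n=\Theta_{i=1}^{M} L^i_n$, where $L^1_n=l^{n-1}_1\circ s(2,2)$ and, for $i>1$, $L^i_n=l^{n-1}_i\circ s\big(\overrightarrow{l^{n-1}_i},\overrightarrow{\mathrm{last}(L^{i-1}_n)}\big)$.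 *)

theory Defs
  imports Main
begin

type_synonym word = "nat list"

text \<open>
  Used only for \<open>k \<ge> 2\<close> and \<open>2 \<le> i \<le> k + 1\<close>; values outside this range are irrelevant.
\<close>
definition shifted_prod :: "nat \<Rightarrow> nat \<Rightarrow> nat list" where
  "shifted_prod k i =
     (if i = 2 then 2 # rev [3..<k + 2] else [i..<k + 2] @ [2..<i])"

definition append_each :: "word \<Rightarrow> nat list \<Rightarrow> word list" where
  "append_each x ds = map (\<lambda>d. x @ [d]) ds"

text \<open>
  The blocks are indexed from 0: \<open>block ls i\<close> is the list of successors of \<open>ls ! i\<close>,
  where \<open>ls\<close> is the list of words of the previous length.
  In \<open>last (last (block ls i))\<close>, the inner \<open>last\<close> is the last word of the preceding block
  and the outer \<open>last\<close> is the rightmost digit of that word.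
\<close>
fun block :: "word list \<Rightarrow> nat \<Rightarrow> word list" where
  "block ls 0 = append_each (ls ! 0) (shifted_prod 2 2)"
| "block ls (Suc i) =
     append_each (ls ! Suc i)
       (shifted_prod (last (ls ! Suc i)) (last (last (block ls i))))"

text \<open>The lists are defined for \<open>n \<ge> 1\<close>; the value at \<open>0\<close> is a dummy.\<close>
fun catalan_list :: "nat \<Rightarrow> word list" where
  "catalan_list 0 = []"
| "catalan_list (Suc 0) = [[2]]"
| "catalan_list (Suc (Suc n)) =
     (let ls = catalan_list (Suc n) in concat (map (block ls) [0..<length ls]))"

text \<open>Meaningful for words of equal length.\<close>
definition hamming_dist :: "word \<Rightarrow> word \<Rightarrow> nat" where
  "hamming_dist x y = card {j. j < length x \<and> x ! j \<noteq> y ! j}"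

end

theory Submission
  imports Defs
begin

text \<open>
  If a block starts with the digit 2 then it ends with 3, and conversely, so the shifts used
  alternate between 2 and 3. These are available in every production, hence each
  block starts with the digit on which the preceding one ended, and two words meeting at a block
  boundary inherit their distance from their prefixes.
\<close>

text \<open>Equal length is included because \<open>hamming_dist\<close> inspects only the positions
  of its first argument, and because it aligns digits appended to both words.\<close>

definition adjacent :: "word \<Rightarrow> word \<Rightarrow> bool" where
  "adjacent x y \<longleftrightarrow> length x = length y \<and> hamming_dist x y = 1"

lemma adjacent_same_prefix:
  assumes "c \<noteq> d"
  shows "adjacent (x @ [c]) (x @ [d])"
proof -
  have "{j. j < length (x @ [c]) \<and> (x @ [c]) ! j \<noteq> (x @ [d]) ! j} = {length x}"
    using assms by (auto simp: nth_append less_Suc_eq)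
  then show ?thesis
    by (simp add: adjacent_def hamming_dist_def)
qed

lemma adjacent_same_suffix:
  assumes "adjacent x y"
  shows "adjacent (x @ [d]) (y @ [d])"
proof -
  have "{j. j < length (x @ [d]) \<and> (x @ [d]) ! j \<noteq> (y @ [d]) ! j}
      = {j. j < length x \<and> x ! j \<noteq> y ! j}"
    using assms by (auto simp: adjacent_def nth_append less_Suc_eq)
  then have "hamming_dist (x @ [d]) (y @ [d]) = hamming_dist x y"
    unfolding hamming_dist_def by (rule arg_cong)
  then show ?thesis
    using assms by (simp add: adjacent_def)
qed

lemma shifted_prod_not_Nil:
  assumes "k \<ge> 2" "i \<in> {2, 3}"
  shows "shifted_prod k i \<noteq> []"
  using assms by (auto simp: shifted_prod_def)

lemma distinct_shifted_prod: "distinct (shifted_prod k i)"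
  by (auto simp: shifted_prod_def)

lemma shifted_prod_ge_2:
  assumes "i \<ge> 2" "d \<in> set (shifted_prod k i)"
  shows "d \<ge> 2"
  using assms by (auto simp: shifted_prod_def split: if_splits)

lemma hd_shifted_prod:
  assumes "k \<ge> 2" "i \<in> {2, 3}"
  shows "hd (shifted_prod k i) = i"
  using assms by (auto simp: shifted_prod_def hd_append)

text \<open>Subtraction from 5 swaps 2 and 3: shift 2 reverses an interval that starts at 3, while
  shift 3 leaves just the digit 2 to be moved to the end.\<close>

lemma last_shifted_prod:
  assumes "k \<ge> 2" "i \<in> {2, 3}"
  shows "last (shifted_prod k i) = 5 - i"
  using assms by (auto simp: shifted_prod_def last_rev hd_append)

text \<open>Words of one block differ only in the appended digit, so distinct digits suffice,
  whatever their order.\<close>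

lemma successively_append_each:
  assumes "distinct ds"
  shows "successively adjacent (append_each x ds)"
  unfolding successively_conv_nth
proof (intro allI impI)
  fix i
  assume i: "Suc i < length (append_each x ds)"
  then have "ds ! i \<noteq> ds ! Suc i"
    using assms by (simp add: append_each_def nth_eq_iff_index_eq)
  then show "adjacent (append_each x ds ! i) (append_each x ds ! Suc i)"
    using i by (simp add: append_each_def adjacent_same_prefix)
qed

lemma last_append_each: "ds \<noteq> [] \<Longrightarrow> last (append_each x ds) = x @ [last ds]"
  by (simp add: append_each_def last_map)

lemma hd_append_each: "ds \<noteq> [] \<Longrightarrow> hd (append_each x ds) = x @ [hd ds]"
  by (simp add: append_each_def hd_map)

text \<open>Resolves the recursion of \<open>block\<close>: the shift depends only on the parity of
  the index. The bound \<open>k\<close> \<ge> 2 is all that the facts on first and last digits ask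
  of \<open>k\<close>, so its value may stay hidden.\<close>

lemma block_eq:
  assumes "\<And>w. w \<in> set ls \<Longrightarrow> last w \<ge> 2" and "i < length ls"
  shows "\<exists>k\<ge>2. block ls i = append_each (ls ! i) (shifted_prod k (2 + i mod 2))"
  using assms(2)
proof (induction i)
  case 0
  then show ?case by auto
next
  case (Suc i)
  then obtain k where k: "k \<ge> 2"
    "block ls i = append_each (ls ! i) (shifted_prod k (2 + i mod 2))"
    by auto
  have i: "2 + i mod 2 \<in> {2, 3}" by auto
  have "last (last (block ls i)) = 5 - (2 + i mod 2)"
    using k(2) last_shifted_prod[OF k(1) i] last_append_each[OF shifted_prod_not_Nil[OF k(1) i]]
    by simp
  also have "\<dots> = 2 + Suc i mod 2"
    by presburger
  finally have "block ls (Suc i)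
      = append_each (ls ! Suc i) (shifted_prod (last (ls ! Suc i)) (2 + Suc i mod 2))"
    by simp
  \<comment> \<open>The witness is the last digit of \<open>ls ! Suc i\<close>, which is at least 2
    by assumption.\<close>
  then show ?case
    using assms(1)[OF nth_mem[OF Suc.prems]] by blast
qed

text \<open>Taking only the first \<open>m\<close> blocks allows induction on \<open>m\<close>: each
  step adds one block and one boundary to check.\<close>

lemma successively_blocks:
  assumes adj: "successively adjacent ls" and ge: "\<And>w. w \<in> set ls \<Longrightarrow> last w \<ge> 2"
    and "m \<le> length ls"
  shows "successively adjacent (concat (map (block ls) [0..<m]))"
  using assms(3)
proof (induction m)
  case 0
  then show ?case by simp
next
  case (Suc m)
  obtain k where k: "k \<ge> 2"
    "block ls m = append_each (ls ! m) (shifted_prod k (2 + m mod 2))"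
    using block_eq[of ls m, OF ge] Suc.prems by auto
  have m: "2 + m mod 2 \<in> {2, 3}" by auto
  have block: "successively adjacent (block ls m)"
    using k(2) by (simp add: successively_append_each distinct_shifted_prod)
  show ?case
  proof (cases m)
    case 0
    then show ?thesis using block by simp
  next
    case (Suc p)
    obtain l where l: "l \<ge> 2"
      "block ls p = append_each (ls ! p) (shifted_prod l (2 + p mod 2))"
      using block_eq[of ls p, OF ge] Suc.prems Suc by auto
    have p: "2 + p mod 2 \<in> {2, 3}" by auto
    \<comment> \<open>Without this, the last word of the concatenation could come from an earlier
      block.\<close>
    have "block ls p \<noteq> []"
      using l(2) shifted_prod_not_Nil[OF l(1) p] by (simp add: append_each_def)
    then have "last (concat (map (block ls) [0..<m])) = last (block ls p)"
      using Suc by simp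
    also have "\<dots> = ls ! p @ [5 - (2 + p mod 2)]"
      using l(2) last_shifted_prod[OF l(1) p] last_append_each[OF shifted_prod_not_Nil[OF l(1) p]]
      by simp
    also have "5 - (2 + p mod 2) = 2 + m mod 2"
      using Suc by presburger
    finally have last: "last (concat (map (block ls) [0..<m])) = ls ! p @ [2 + m mod 2]" .
    have "hd (block ls m) = ls ! m @ [2 + m mod 2]"
      using k(2) hd_shifted_prod[OF k(1) m] hd_append_each[OF shifted_prod_not_Nil[OF k(1) m]]
      by simp
    \<comment> \<open>The prefixes at the boundary are consecutive in \<open>ls\<close>; here
      adjacency in the shorter list enters.\<close>
    moreover have "adjacent (ls ! p) (ls ! m)"
      using adj Suc Suc.prems by (auto simp: successively_conv_nth)
    ultimately have "adjacent (last (concat (map (block ls) [0..<m]))) (hd (block ls m))"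
      using last adjacent_same_suffix by simp
    then show ?thesis
      using Suc.IH Suc.prems block by (simp add: successively_append_iff)
  qed
qed

text \<open>Provides the digit bound that \<open>block_eq\<close> requires; the two are used
  alternately, one length at a time.\<close>

lemma catalan_list_last_ge_2:
  assumes "w \<in> set (catalan_list n)"
  shows "last w \<ge> 2"
  using assms
proof (induction n arbitrary: w rule: catalan_list.induct)
  case (3 n)
  let ?ls = "catalan_list (Suc n)"
  obtain i where i: "i < length ?ls" "w \<in> set (block ?ls i)"
    using "3.prems" by (auto simp: Let_def)
  obtain k where "block ?ls i = append_each (?ls ! i) (shifted_prod k (2 + i mod 2))"
    using block_eq[OF "3.IH" i(1)] by auto
  then show ?case
    using i(2) shifted_prod_ge_2[of "2 + i mod 2"] by (auto simp: append_each_def)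
qed auto

lemma successively_catalan_list: "successively adjacent (catalan_list n)"
proof (induction n rule: catalan_list.induct)
  case (3 n)
  then show ?case
    using successively_blocks[OF "3.IH" catalan_list_last_ge_2 order_refl]
    by (simp only: catalan_list.simps Let_def)
qed simp_all

theorem theorem1:
  fixes n i :: nat
  assumes "n \<ge> 1"
    and "Suc i < length (catalan_list n)"
  shows "length (catalan_list n ! i) = length (catalan_list n ! Suc i) \<and>
         hamming_dist (catalan_list n ! i) (catalan_list n ! Suc i) = 1"
  using successively_catalan_list[of n] assms(2)
  by (simp add: successively_conv_nth adjacent_def)

end
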